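(* Let $J$ be an ideal on $\omega$. Then $\mathcal{N}_J\preceq_{\mathrm{T}}\mathbf{S}_J$ and $\mathcal{N}^*_J\preceq_{\mathrm{T}}\mathbf{S}_J$. In particular, $\mathfrak{b}_J(\overline{\Omega})\le\min\{\mathrm{add}(\mathcal{N}_J),\mathrm{add}(\mathcal{N}^*_J)\}$ and $\max\{\mathrm{cof}(\mathcal{N}_J),\mathrm{cof}(\mathcal{N}^*_J)\}\le\mathfrak{d}_J(\overline{\Omega})$.
   Context: An ideal on $\omega$ is a family $J\subseteq\mathcal{P}(\omega)$ closed under subsets and finite unions, containing all finite sets, with $\omega\notin J$; $J^+=\mathcal{P}(\omega)\setminus J$, $J^d=\{\omega\setminus a:a\in J\}$. ${}^\omega2$ has Lebesgue measure $\mu$; $\Omega$ is the set of clopen subsets. For $\bar c\in{}^\omega\Omega$: $N(\bar c)=\{x:x\in c_n\text{ for infinitely many }n\}$, $\overline{\Omega}=\{\bar c:\mu(N(\bar c))=0\}$, $N_J(\bar c)=\{x:\{n:x\in c_n\}\in J^+\}$, $N^*_J(\bar c)=\{x:\{n:x\in c_n\}\in J^d\}$, $\mathcal{N}_J=\{X\subseteq{}^\omega2:\exists\bar c\in\overline{\Omega}\ X\subseteq N_J(\bar c)\}$, $\mathcal{N}^*_J=\{X:\exists\bar c\in\overline{\Omega}\ X\subseteq N^*_J(\bar c)\}$. A relational system is $\mathbf{R}=\langle X,Y,R\rangle$; $\mathfrak{b}(\mathbf{R})=\min\{|F|:F\subseteq X,\ \neg\exists y\in Y\,\forall x\in F\ xRy\}$,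 $\mathfrak{d}(\mathbf{R})=\min\{|D|:D\subseteq Y,\ \forall x\in X\,\exists y\in D\ xRy\}$. $\mathbf{R}\preceq_{\mathrm{T}}\mathbf{R}'=\langle X',Y',R'\rangle$ iff there are $\varphi_-:X\to X'$, $\varphi_+:Y'\to Y$ with $\varphi_-(x)R'y'\Rightarrow xR\varphi_+(y')$. An ideal $\mathcal{I}$ is identified with $\langle\mathcal{I},\mathcal{I},\subseteq\rangle$, so $\mathfrak{b}$ and $\mathfrak{d}$ of it are $\mathrm{add}(\mathcal{I})$ and $\mathrm{cof}(\mathcal{I})$. For $\bar c,\bar d\in\overline{\Omega}$, $\bar c\subseteq^J\bar d$ iff $\{n:c_n\not\subseteq d_n\}\in J$; $\mathbf{S}_J=\langle\overline{\Omega},\overline{\Omega},\subseteq^J\rangle$, $\mathfrak{b}_J(\overline{\Omega})=\mathfrak{b}(\mathbf{S}_J)$, $\mathfrak{d}_J(\overline{\Omega})=\mathfrak{d}(\mathbf{S}_J)$. *)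

theory Defs
  imports "HOL-Probability.Probability"
begin

notation ordLeq3 (infix "\<le>o" 50)

text \<open>Cardinals are rendered as in the BNF cardinal library: \<^term>\<open>card_of A\<close> is a cardinal order
  on the type of \<^term>\<open>A\<close>, and \<^term>\<open>(\<le>o)\<close> compares cardinals over possibly different types.
  Least and greatest elements are determined up to order isomorphism, hence the choice operator.\<close>

definition Min_card :: "'a rel set \<Rightarrow> 'a rel" where
  "Min_card A = (SOME r. r \<in> A \<and> (\<forall>s\<in>A. r \<le>o s))"

definition Max_card :: "'a rel set \<Rightarrow> 'a rel" where
  "Max_card A = (SOME r. r \<in> A \<and> (\<forall>s\<in>A. s \<le>o r))"

lemma Min_card_least:
  assumes "A \<noteq> {}" and "\<And>r. r \<in> A \<Longrightarrow> Card_order r"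
  shows "Min_card A \<in> A" and "\<And>s. s \<in> A \<Longrightarrow> Min_card A \<le>o s"
proof -
  have "\<exists>r. r \<in> A \<and> (\<forall>s\<in>A. r \<le>o s)"
    using exists_minim_Card_order[of A] assms by blast
  from someI_ex[OF this] show "Min_card A \<in> A" and "\<And>s. s \<in> A \<Longrightarrow> Min_card A \<le>o s"
    unfolding Min_card_def by blast+
qed

lemma Max_card_greatest:
  assumes "Card_order r" and "Card_order s"
  shows "Max_card {r, s} \<in> {r, s}" and "r \<le>o Max_card {r, s}" and "s \<le>o Max_card {r, s}"
proof -
  have wo: "Well_order r" "Well_order s"
    using assms by (simp_all add: card_order_on_def)
  have "\<exists>t. t \<in> {r, s} \<and> (\<forall>u\<in>{r, s}. u \<le>o t)"
    using ordLeq_total[OF wo] ordLeq_reflexive[OF wo(1)] ordLeq_reflexive[OF wo(2)] by blast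
  from someI_ex[OF this]
  show "Max_card {r, s} \<in> {r, s}" and "r \<le>o Max_card {r, s}" and "s \<le>o Max_card {r, s}"
    unfolding Max_card_def by blast+
qed

type_synonym ('a, 'b) relsys = "'a set \<times> 'b set \<times> ('a \<Rightarrow> 'b \<Rightarrow> bool)"

fun bnum :: "('a, 'b) relsys \<Rightarrow> 'a rel" where
  "bnum (X, Y, R) = Min_card {card_of F | F. F \<subseteq> X \<and> \<not> (\<exists>y\<in>Y. \<forall>x\<in>F. R x y)}"

fun dnum :: "('a, 'b) relsys \<Rightarrow> 'b rel" where
  "dnum (X, Y, R) = Min_card {card_of D | D. D \<subseteq> Y \<and> (\<forall>x\<in>X. \<exists>y\<in>D. R x y)}"

fun tukey_le :: "('a, 'b) relsys \<Rightarrow> ('c, 'd) relsys \<Rightarrow> bool" (infix "\<preceq>\<^sub>T" 50) where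
  "(X, Y, R) \<preceq>\<^sub>T (X', Y', R') \<longleftrightarrow>
     (\<exists>\<phi>m \<phi>p. \<phi>m \<in> X \<rightarrow> X' \<and> \<phi>p \<in> Y' \<rightarrow> Y \<and>
        (\<forall>x\<in>X. \<forall>y'\<in>Y'. R' (\<phi>m x) y' \<longrightarrow> R x (\<phi>p y')))"

definition incl_sys :: "'a set set \<Rightarrow> ('a set, 'a set) relsys" where
  "incl_sys \<I> = (\<I>, \<I>, (\<subseteq>))"

definition add_ideal :: "'a set set \<Rightarrow> 'a set rel" where
  "add_ideal \<I> = bnum (incl_sys \<I>)"

definition cof_ideal :: "'a set set \<Rightarrow> 'a set rel" where
  "cof_ideal \<I> = dnum (incl_sys \<I>)"

definition ideal_on_omega :: "nat set set \<Rightarrow> bool" where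
  "ideal_on_omega J \<longleftrightarrow>
     (\<forall>a\<in>J. \<forall>b. b \<subseteq> a \<longrightarrow> b \<in> J) \<and>
     (\<forall>a\<in>J. \<forall>b\<in>J. a \<union> b \<in> J) \<and>
     (\<forall>a. finite a \<longrightarrow> a \<in> J) \<and>
     UNIV \<notin> J"

definition positive :: "nat set set \<Rightarrow> nat set set" where
  "positive J = UNIV - J"

definition dual_filter :: "nat set set \<Rightarrow> nat set set" where
  "dual_filter J = {UNIV - a | a. a \<in> J}"

type_synonym cantor = "nat \<Rightarrow> bool"

definition cantor_measure :: "cantor measure" where
  "cantor_measure = Pi\<^sub>M UNIV (\<lambda>_::nat. measure_pmf (bernoulli_pmf (1/2)))"

definition clopens :: "cantor set set" where
  "clopens = {c. open c \<and> closed c}"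

definition N_inf :: "(nat \<Rightarrow> cantor set) \<Rightarrow> cantor set" where
  "N_inf c = {x. infinite {n. x \<in> c n}}"

text \<open>\<^term>\<open>N_inf c\<close> is Borel for clopen \<^term>\<open>c n\<close>, so membership in \<^term>\<open>null_sets\<close> says exactly that
  its measure is 0; unlike \<^term>\<open>emeasure\<close>, it does not rely on the value at non-measurable sets.\<close>

definition Omega_bar :: "(nat \<Rightarrow> cantor set) set" where
  "Omega_bar = {c. (\<forall>n. c n \<in> clopens) \<and> N_inf c \<in> null_sets cantor_measure}"

definition N_of :: "nat set set \<Rightarrow> (nat \<Rightarrow> cantor set) \<Rightarrow> cantor set" where
  "N_of J c = {x. {n. x \<in> c n} \<in> positive J}"

definition N_star_of :: "nat set set \<Rightarrow> (nat \<Rightarrow> cantor set) \<Rightarrow> cantor set" where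
  "N_star_of J c = {x. {n. x \<in> c n} \<in> dual_filter J}"

definition NJ :: "nat set set \<Rightarrow> cantor set set" where
  "NJ J = {X. \<exists>c\<in>Omega_bar. X \<subseteq> N_of J c}"

definition NJ_star :: "nat set set \<Rightarrow> cantor set set" where
  "NJ_star J = {X. \<exists>c\<in>Omega_bar. X \<subseteq> N_star_of J c}"

definition subset_mod :: "nat set set \<Rightarrow> (nat \<Rightarrow> cantor set) \<Rightarrow> (nat \<Rightarrow> cantor set) \<Rightarrow> bool" where
  "subset_mod J c d \<longleftrightarrow> {n. \<not> c n \<subseteq> d n} \<in> J"

definition S_sys :: "nat set set \<Rightarrow> (nat \<Rightarrow> cantor set, nat \<Rightarrow> cantor set) relsys" where
  "S_sys J = (Omega_bar, Omega_bar, subset_mod J)"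

definition b_Omega :: "nat set set \<Rightarrow> (nat \<Rightarrow> cantor set) rel" where
  "b_Omega J = bnum (S_sys J)"

definition d_Omega :: "nat set set \<Rightarrow> (nat \<Rightarrow> cantor set) rel" where
  "d_Omega J = dnum (S_sys J)"

end

theory Submission
  imports Defs
begin

text \<open>The Tukey connection sends a set of the ideal to a sequence witnessing its membership, and a
  sequence \<open>d\<close> to the set it generates; it works because enlarging a sequence modulo \<open>J\<close> enlarges
  the generated set. The inequalities between the cardinals need the sets of cardinals involved to
  be nonempty. For the additivity this holds because both ideals contain all singletons but not the
  whole space: their members are subsets of the null sets \<open>N_inf c\<close>.\<close>

section \<open>Least cardinals and Tukey connections between arbitrary relational systems\<close>

lemma Min_card_mono:
  assumes "B \<noteq> {}" and "\<And>r. r \<in> A \<Longrightarrow> Card_order r" and "\<And>r. r \<in> B \<Longrightarrow> Card_order r"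
    and "\<And>s. s \<in> B \<Longrightarrow> \<exists>r\<in>A. r \<le>o s"
  shows "Min_card A \<le>o Min_card B"
proof -
  \<comment> \<open>The least cardinal of \<open>B\<close> is itself a member of \<open>B\<close>,
    so the last assumption supplies a member of \<open>A\<close> below it.\<close>
  obtain r where r: "r \<in> A" "r \<le>o Min_card B"
    using assms(4)[OF Min_card_least(1)[OF assms(1,3)]] by blast
  then have "Min_card A \<le>o r"
    using Min_card_least(2)[OF _ assms(2)] by blast
  then show ?thesis
    using r(2) by (rule ordLeq_transitive)
qed

text \<open>The first Tukey map sends unbounded families to unbounded families of no larger
  cardinality: the second map would turn a bound of the image into a bound of the original family.
  The second assumption says that \<open>X\<close> itself is unbounded, so
  \<open>bnum (X, Y, R)\<close> is a minimum over a nonempty set and not an arbitrary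
  choice.\<close>

lemma bnum_antimono:
  assumes "(X, Y, R) \<preceq>\<^sub>T (X', Y', R')" and "\<not> (\<exists>y\<in>Y. \<forall>x\<in>X. R x y)"
  shows "bnum (X', Y', R') \<le>o bnum (X, Y, R)"
proof -
  obtain f g where f: "f \<in> X \<rightarrow> X'" and g: "g \<in> Y' \<rightarrow> Y"
    and fg: "\<And>x y'. x \<in> X \<Longrightarrow> y' \<in> Y' \<Longrightarrow> R' (f x) y' \<Longrightarrow> R x (g y')"
    using assms(1) by auto
  have image_unbounded: "f ` F \<subseteq> X' \<and> \<not> (\<exists>y\<in>Y'. \<forall>x\<in>f ` F. R' x y)"
    if sub: "F \<subseteq> X" and unbounded: "\<not> (\<exists>y\<in>Y. \<forall>x\<in>F. R x y)" for F
  proof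
    show "f ` F \<subseteq> X'" using sub f by auto
    show "\<not> (\<exists>y\<in>Y'. \<forall>x\<in>f ` F. R' x y)"
    proof
      assume "\<exists>y\<in>Y'. \<forall>x\<in>f ` F. R' x y"
      then obtain y where y: "y \<in> Y'" "\<And>x. x \<in> F \<Longrightarrow> R' (f x) y" by auto
      then have "\<forall>x\<in>F. R x (g y)" using fg sub by blast
      then show False using unbounded g y(1) by blast
    qed
  qed
  show ?thesis
    unfolding bnum.simps
  proof (rule Min_card_mono)
    show "{card_of F |F. F \<subseteq> X \<and> \<not> (\<exists>y\<in>Y. \<forall>x\<in>F. R x y)} \<noteq> {}"
      using assms(2) by blast
  next
    fix s assume "s \<in> {card_of F |F. F \<subseteq> X \<and> \<not> (\<exists>y\<in>Y. \<forall>x\<in>F. R x y)}"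
    then obtain F where F: "s = card_of F" "F \<subseteq> X" "\<not> (\<exists>y\<in>Y. \<forall>x\<in>F. R x y)"
      by blast
    have "card_of (f ` F) \<in> {card_of F |F. F \<subseteq> X' \<and> \<not> (\<exists>y\<in>Y'. \<forall>x\<in>F. R' x y)}"
      using image_unbounded[OF F(2,3)] by (intro CollectI exI[of _ "f ` F"] conjI refl) auto
    then show "\<exists>r\<in>{card_of F |F. F \<subseteq> X' \<and> \<not> (\<exists>y\<in>Y'. \<forall>x\<in>F. R' x y)}. r \<le>o s"
      unfolding F(1) using card_of_image by (rule bexI[rotated])
  qed (auto simp: card_of_Card_order)
qed

text \<open>Dually, the second Tukey map sends dominating families to dominating families of no
  larger cardinality. The second assumption makes \<open>Y'\<close> itself dominating, so the
  minimum on the right exists.\<close>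

lemma dnum_mono:
  assumes "(X, Y, R) \<preceq>\<^sub>T (X', Y', R')" and "\<forall>x\<in>X'. \<exists>y\<in>Y'. R' x y"
  shows "dnum (X, Y, R) \<le>o dnum (X', Y', R')"
proof -
  obtain f g where f: "f \<in> X \<rightarrow> X'" and g: "g \<in> Y' \<rightarrow> Y"
    and fg: "\<And>x y'. x \<in> X \<Longrightarrow> y' \<in> Y' \<Longrightarrow> R' (f x) y' \<Longrightarrow> R x (g y')"
    using assms(1) by auto
  have image_dominating: "g ` D \<subseteq> Y \<and> (\<forall>x\<in>X. \<exists>y\<in>g ` D. R x y)"
    if sub: "D \<subseteq> Y'" and dom: "\<forall>x\<in>X'. \<exists>y\<in>D. R' x y" for D
  proof
    show "g ` D \<subseteq> Y" using sub g by auto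
    show "\<forall>x\<in>X. \<exists>y\<in>g ` D. R x y"
    proof
      fix x assume x: "x \<in> X"
      then obtain y where "y \<in> D" "R' (f x) y" using dom f by blast
      then show "\<exists>y\<in>g ` D. R x y" using fg[OF x] sub by blast
    qed
  qed
  show ?thesis
    unfolding dnum.simps
  proof (rule Min_card_mono)
    show "{card_of D |D. D \<subseteq> Y' \<and> (\<forall>x\<in>X'. \<exists>y\<in>D. R' x y)} \<noteq> {}"
      using assms(2) by blast
  next
    fix s assume "s \<in> {card_of D |D. D \<subseteq> Y' \<and> (\<forall>x\<in>X'. \<exists>y\<in>D. R' x y)}"
    then obtain D where D: "s = card_of D" "D \<subseteq> Y'" "\<forall>x\<in>X'. \<exists>y\<in>D. R' x y"
      by blast
    have "card_of (g ` D) \<in> {card_of D |D. D \<subseteq> Y \<and> (\<forall>x\<in>X. \<exists>y\<in>D. R x y)}"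
      using image_dominating[OF D(2,3)] by (intro CollectI exI[of _ "g ` D"] conjI refl) auto
    then show "\<exists>r\<in>{card_of D |D. D \<subseteq> Y \<and> (\<forall>x\<in>X. \<exists>y\<in>D. R x y)}. r \<le>o s"
      unfolding D(1) using card_of_image by (rule bexI[rotated])
  qed (auto simp: card_of_Card_order)
qed

text \<open>\<open>Min_card_least\<close> and \<open>Max_card_greatest\<close> are stated for
  cardinal orders; this lemma and the next one allow them to be applied to the invariants
  themselves.\<close>

lemma Card_order_bnum:
  assumes "\<not> (\<exists>y\<in>Y. \<forall>x\<in>X. R x y)"
  shows "Card_order (bnum (X, Y, R))"
proof -
  have "bnum (X, Y, R) \<in> {card_of F |F. F \<subseteq> X \<and> \<not> (\<exists>y\<in>Y. \<forall>x\<in>F. R x y)}"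
    unfolding bnum.simps using assms by (intro Min_card_least(1)) (auto simp: card_of_Card_order)
  then show ?thesis by (auto simp: card_of_Card_order simp del: bnum.simps)
qed

lemma Card_order_dnum:
  assumes "\<forall>x\<in>X. \<exists>y\<in>Y. R x y"
  shows "Card_order (dnum (X, Y, R))"
proof -
  have "dnum (X, Y, R) \<in> {card_of D |D. D \<subseteq> Y \<and> (\<forall>x\<in>X. \<exists>y\<in>D. R x y)}"
    unfolding dnum.simps using assms by (intro Min_card_least(1)) (auto simp: card_of_Card_order)
  then show ?thesis by (auto simp: card_of_Card_order simp del: dnum.simps)
qed

section \<open>The fair coin measure on Cantor space: cylinders and points\<close>

lemma prob_space_cantor_measure: "prob_space cantor_measure"
  unfolding cantor_measure_def by (intro prob_space_PiM prob_space_measure_pmf)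

lemma UNIV_notin_null_sets_cantor_measure: "UNIV \<notin> null_sets cantor_measure"
proof -
  have "space cantor_measure = UNIV"
    by (simp add: cantor_measure_def space_PiM)
  then show ?thesis
    using prob_space.emeasure_space_1[OF prob_space_cantor_measure] by auto
qed

text \<open>Coordinates are continuous into a discrete space, so fixing one coordinate is a clopen
  condition, and only finitely many are fixed.\<close>

lemma cylinder_clopen: "{y. \<forall>i<n. y i = x i} \<in> clopens"
proof -
  have "open {y::cantor. y i = x i}" "closed {y::cantor. y i = x i}" for i
    using open_vimage[OF Topological_Spaces.open_discrete[of "{x i}"] continuous_on_product_coordinates[of i]]
      closed_vimage[OF closed_singleton[of "x i"] continuous_on_product_coordinates[of i]]
    by (simp_all add: vimage_def)
  moreover have "{y. \<forall>i<n. y i = x i} = (\<Inter>i\<in>{..<n}. {y. y i = x i})"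
    by auto
  ultimately show ?thesis
    unfolding clopens_def by (auto intro!: open_INT closed_INT)
qed

text \<open>The product measure factorises over the \<open>n\<close> fixed coordinates, and a fair
  coin gives either truth value mass 1/2.\<close>

lemma cylinder_measure:
  shows "{y. \<forall>i<n. y i = x i} \<in> sets cantor_measure"
    and "emeasure cantor_measure {y. \<forall>i<n. y i = x i} = ennreal ((1/2) ^ n)"
proof -
  have prod: "product_prob_space (\<lambda>_::nat. measure_pmf (bernoulli_pmf (1/2)))"
    by (rule product_prob_spaceI) (rule prob_space_measure_pmf)
  have eq: "{y. \<forall>i<n. y i = x i} =
    {y \<in> space cantor_measure. \<forall>i\<in>{..<n}. y i \<in> {x i}}"
    by (auto simp: cantor_measure_def space_PiM)
  show "{y. \<forall>i<n. y i = x i} \<in> sets cantor_measure"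
    unfolding eq cantor_measure_def by (intro sets.sets_Collect_finite_All sets_Collect_single') auto
  have "emeasure cantor_measure {y. \<forall>i<n. y i = x i} =
    (\<Prod>i<n. emeasure (measure_pmf (bernoulli_pmf (1/2))) {x i})"
    unfolding eq cantor_measure_def
    by (rule product_prob_space.emeasure_PiM_Collect[OF prod]) auto
  also have "\<dots> = (\<Prod>i<n. ennreal (1/2))"
  proof (rule prod.cong[OF refl])
    fix i
    show "emeasure (measure_pmf (bernoulli_pmf (1/2))) {x i} = ennreal (1/2)"
      by (cases "x i") (simp_all add: emeasure_pmf_single)
  qed
  also have "\<dots> = ennreal ((1/2) ^ n)"
    by (subst prod_ennreal) auto
  finally show "emeasure cantor_measure {y. \<forall>i<n. y i = x i} = ennreal ((1/2) ^ n)" .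
qed

text \<open>The point lies in cylinders of measure \<open>(1/2) ^ n\<close> for every
  \<open>n\<close>.\<close>

lemma singleton_null_cantor_measure: "{x} \<in> null_sets cantor_measure"
proof
  have eq: "{x} = (\<Inter>n. {y. \<forall>i<n. y i = x i})"
    by auto
  show "{x} \<in> sets cantor_measure"
    unfolding eq by (intro sets.countable_INT) (auto simp: cylinder_measure(1))
  have le: "emeasure cantor_measure {x} \<le> ennreal ((1/2) ^ n)" for n
    unfolding cylinder_measure(2)[of n x, symmetric]
    by (intro emeasure_mono cylinder_measure(1)) auto
  have "(\<lambda>n. ennreal ((1/2) ^ n)) \<longlonglongrightarrow> ennreal 0"
    by (intro tendsto_ennrealI LIMSEQ_power_zero) auto
  then have "emeasure cantor_measure {x} \<le> ennreal 0"
    by (rule tendsto_lowerbound) (auto intro: always_eventually le)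
  then show "emeasure cantor_measure {x} = 0" by simp
qed

text \<open>These cylinders shrink to \<open>x\<close>; they later witness that \<open>{x}\<close>
  belongs to both ideals.\<close>

lemma cylinders_in_Omega_bar: "(\<lambda>n. {y. \<forall>i<n. y i = x i}) \<in> Omega_bar"
proof -
  have "N_inf (\<lambda>n. {y. \<forall>i<n. y i = x i}) \<subseteq> {x}"
  proof
    fix y assume "y \<in> N_inf (\<lambda>n. {y. \<forall>i<n. y i = x i})"
    then have inf: "infinite {n. \<forall>i<n. y i = x i}" by (simp add: N_inf_def)
    \<comment> \<open>An infinite index set contains some \<open>n\<close> above \<open>i\<close>,
      and agreement below that \<open>n\<close> includes agreement at \<open>i\<close>.\<close>
    have "y i = x i" for i
      using inf unfolding infinite_nat_iff_unbounded by auto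
    then show "y \<in> {x}" by auto
  qed
  \<comment> \<open>Equality with \<open>{x}\<close>, rather than inclusion, also settles the
    measurability required by \<open>null_sets\<close>.\<close>
  moreover have "x \<in> N_inf (\<lambda>n. {y. \<forall>i<n. y i = x i})"
    by (simp add: N_inf_def)
  ultimately have "N_inf (\<lambda>n. {y. \<forall>i<n. y i = x i}) = {x}" by blast
  then show ?thesis
    using singleton_null_cantor_measure by (simp add: Omega_bar_def cylinder_clopen)
qed

section \<open>The sets generated by a sequence modulo a fixed ideal, and the resulting
  connections\<close>

context
  fixes J :: "nat set set"
  assumes J: "ideal_on_omega J"
begin

lemma ideal_subset: "a \<in> J \<Longrightarrow> b \<subseteq> a \<Longrightarrow> b \<in> J"
  and ideal_Un: "a \<in> J \<Longrightarrow> b \<in> J \<Longrightarrow> a \<union> b \<in> J"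
  and ideal_finite: "finite a \<Longrightarrow> a \<in> J"
  and ideal_UNIV: "UNIV \<notin> J"
  using J unfolding ideal_on_omega_def by blast+

lemma dual_filter_iff: "a \<in> dual_filter J \<longleftrightarrow> - a \<in> J"
  unfolding dual_filter_def Compl_eq_Diff_UNIV[symmetric] by (auto intro: exI[of _ "- a"])

text \<open>Passing from \<open>c\<close> to \<open>d\<close> loses only indices from a set in
  \<open>J\<close>, and a positive set stays positive when such a set is removed.\<close>

lemma N_of_mono:
  assumes "subset_mod J c d"
  shows "N_of J c \<subseteq> N_of J d"
proof
  fix x assume "x \<in> N_of J c"
  then have "{n. x \<in> c n} \<notin> J" by (simp add: N_of_def positive_def)
  moreover have "{n. x \<in> c n} \<subseteq> {n. x \<in> d n} \<union> {n. \<not> c n \<subseteq> d n}" by auto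
  ultimately have "{n. x \<in> d n} \<notin> J"
    using assms ideal_subset ideal_Un unfolding subset_mod_def by blast
  then show "x \<in> N_of J d" by (simp add: N_of_def positive_def)
qed

text \<open>The same loss of indices, seen on complements: the complement of the index set grows
  only by a set in \<open>J\<close>.\<close>

lemma N_star_of_mono:
  assumes "subset_mod J c d"
  shows "N_star_of J c \<subseteq> N_star_of J d"
proof
  fix x assume "x \<in> N_star_of J c"
  then have "- {n. x \<in> c n} \<in> J" by (simp add: N_star_of_def dual_filter_iff)
  moreover have "- {n. x \<in> d n} \<subseteq> - {n. x \<in> c n} \<union> {n. \<not> c n \<subseteq> d n}" by auto
  ultimately have "- {n. x \<in> d n} \<in> J"
    using assms ideal_subset ideal_Un unfolding subset_mod_def by blast
  then show "x \<in> N_star_of J d" by (simp add: N_star_of_def dual_filter_iff)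
qed

text \<open>Positive sets are infinite because \<open>J\<close> contains every finite set.\<close>

lemma N_of_subset_N_inf: "N_of J c \<subseteq> N_inf c"
  using ideal_finite by (auto simp: N_of_def N_inf_def positive_def)

text \<open>A set and its complement cannot both lie in \<open>J\<close>, since their union is
  \<open>UNIV\<close>.\<close>

lemma N_star_of_subset_N_of: "N_star_of J c \<subseteq> N_of J c"
proof
  fix x assume "x \<in> N_star_of J c"
  then have "- {n. x \<in> c n} \<in> J" by (simp add: N_star_of_def dual_filter_iff)
  then have "{n. x \<in> c n} \<notin> J"
    using ideal_Un ideal_UNIV Compl_partition by metis
  then show "x \<in> N_of J c" by (simp add: N_of_def positive_def)
qed

lemma NJ_star_subset_NJ: "NJ_star J \<subseteq> NJ J"
  unfolding NJ_def NJ_star_def using N_star_of_subset_N_of by blast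

lemma singleton_in_NJ_star: "{x} \<in> NJ_star J"
proof -
  \<comment> \<open>The point lies in all of its cylinders, so the complement of the index set is
    empty.\<close>
  have "{x} \<subseteq> N_star_of J (\<lambda>n. {y. \<forall>i<n. y i = x i})"
    by (simp add: N_star_of_def dual_filter_iff ideal_finite)
  then show ?thesis
    unfolding NJ_star_def using cylinders_in_Omega_bar by blast
qed

lemma UNIV_notin_NJ: "UNIV \<notin> NJ J"
proof
  assume "UNIV \<in> NJ J"
  then obtain c where "c \<in> Omega_bar" "UNIV \<subseteq> N_of J c" by (auto simp: NJ_def)
  then have "N_inf c \<in> null_sets cantor_measure" "N_inf c = UNIV"
    using N_of_subset_N_inf by (auto simp: Omega_bar_def)
  then show False using UNIV_notin_null_sets_cantor_measure by simp
qed

text \<open>A greatest member would contain every singleton and hence be the whole space. Letting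
  \<open>\<I>\<close> range between the two ideals treats both at once.\<close>

lemma no_greatest_if_between:
  assumes "NJ_star J \<subseteq> \<I>" and "\<I> \<subseteq> NJ J"
  shows "\<not> (\<exists>Y\<in>\<I>. \<forall>X\<in>\<I>. X \<subseteq> Y)"
proof
  assume "\<exists>Y\<in>\<I>. \<forall>X\<in>\<I>. X \<subseteq> Y"
  then obtain Y where Y: "Y \<in> \<I>" "\<And>X. X \<in> \<I> \<Longrightarrow> X \<subseteq> Y" by blast
  have "x \<in> Y" for x
    using Y(2)[of "{x}"] singleton_in_NJ_star assms(1) by auto
  then have "Y = UNIV" by auto
  then show False using Y(1) assms(2) UNIV_notin_NJ by auto
qed

text \<open>An operator \<open>N\<close> monotone modulo \<open>J\<close> abstracts
  \<open>N_of J\<close> and \<open>N_star_of J\<close>, so that one argument serves both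
  connections.\<close>

lemma tukey_le_S_sys:
  assumes mono: "\<And>c d. subset_mod J c d \<Longrightarrow> N c \<subseteq> N d"
    and ideal: "\<I> = {X. \<exists>c\<in>Omega_bar. X \<subseteq> N c}"
  shows "incl_sys \<I> \<preceq>\<^sub>T S_sys J"
proof -
  have "\<forall>X\<in>\<I>. \<exists>c. c \<in> Omega_bar \<and> X \<subseteq> N c"
    unfolding ideal by blast
  then obtain f where f: "\<And>X. X \<in> \<I> \<Longrightarrow> f X \<in> Omega_bar \<and> X \<subseteq> N (f X)"
    unfolding bchoice_iff by blast
  \<comment> \<open>The second Tukey map is \<open>N\<close> itself: \<open>N d\<close> belongs to
    \<open>\<I>\<close> with \<open>d\<close> as witness.\<close>
  have "f \<in> \<I> \<rightarrow> Omega_bar" "N \<in> Omega_bar \<rightarrow> \<I>"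
    using f by (auto simp: ideal)
  moreover have "\<forall>X\<in>\<I>. \<forall>d\<in>Omega_bar. subset_mod J (f X) d \<longrightarrow> X \<subseteq> N d"
    using f mono by blast
  ultimately show ?thesis
    unfolding incl_sys_def S_sys_def tukey_le.simps by blast
qed

lemma NJ_tukey_le_S_sys: "incl_sys (NJ J) \<preceq>\<^sub>T S_sys J"
  by (rule tukey_le_S_sys[OF N_of_mono NJ_def])

lemma NJ_star_tukey_le_S_sys: "incl_sys (NJ_star J) \<preceq>\<^sub>T S_sys J"
  by (rule tukey_le_S_sys[OF N_star_of_mono NJ_star_def])

lemma subset_mod_refl: "subset_mod J c c"
  by (simp add: subset_mod_def ideal_finite)

lemma b_Omega_le_add_ideal:
  assumes "incl_sys \<I> \<preceq>\<^sub>T S_sys J" and "NJ_star J \<subseteq> \<I>" and "\<I> \<subseteq> NJ J"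
  shows "b_Omega J \<le>o add_ideal \<I>"
  using assms(1) no_greatest_if_between[OF assms(2,3)]
  unfolding b_Omega_def add_ideal_def incl_sys_def S_sys_def by (rule bnum_antimono)

lemma cof_ideal_le_d_Omega:
  assumes "incl_sys \<I> \<preceq>\<^sub>T S_sys J"
  shows "cof_ideal \<I> \<le>o d_Omega J"
proof -
  \<comment> \<open>Reflexivity makes all of \<open>Omega_bar\<close> dominating, as
    \<open>dnum_mono\<close> requires.\<close>
  have "\<forall>c\<in>Omega_bar. \<exists>d\<in>Omega_bar. subset_mod J c d"
    using subset_mod_refl by blast
  with assms show ?thesis
    unfolding d_Omega_def cof_ideal_def incl_sys_def S_sys_def by (rule dnum_mono)
qed

lemma Card_order_add_ideal:
  assumes "NJ_star J \<subseteq> \<I>" and "\<I> \<subseteq> NJ J"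
  shows "Card_order (add_ideal \<I>)"
  unfolding add_ideal_def incl_sys_def by (rule Card_order_bnum[OF no_greatest_if_between[OF assms]])

end

text \<open>Any family of sets is cofinal in itself, so the minimum defining its cofinality
  exists.\<close>

lemma Card_order_cof_ideal: "Card_order (cof_ideal \<I>)"
  unfolding cof_ideal_def incl_sys_def by (rule Card_order_dnum) blast

theorem theorem5p10:
  fixes J :: "nat set set"
  assumes "ideal_on_omega J"
  shows "incl_sys (NJ J) \<preceq>\<^sub>T S_sys J \<and> incl_sys (NJ_star J) \<preceq>\<^sub>T S_sys J \<and>
         b_Omega J \<le>o Min_card {add_ideal (NJ J), add_ideal (NJ_star J)} \<and>
         Max_card {cof_ideal (NJ J), cof_ideal (NJ_star J)} \<le>o d_Omega J"
proof (intro conjI)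
  note sub = NJ_star_subset_NJ[OF assms]
  show tukey: "incl_sys (NJ J) \<preceq>\<^sub>T S_sys J" "incl_sys (NJ_star J) \<preceq>\<^sub>T S_sys J"
    using NJ_tukey_le_S_sys[OF assms] NJ_star_tukey_le_S_sys[OF assms] by simp_all
  \<comment> \<open>The minimum is one of the two additivities, so it suffices to bound each of them
    from below; the maximum of the cofinalities is treated likewise.\<close>
  have "Min_card {add_ideal (NJ J), add_ideal (NJ_star J)} \<in> {add_ideal (NJ J), add_ideal (NJ_star J)}"
    using Card_order_add_ideal[OF assms] sub by (intro Min_card_least(1)) auto
  then show "b_Omega J \<le>o Min_card {add_ideal (NJ J), add_ideal (NJ_star J)}"
    using b_Omega_le_add_ideal[OF assms tukey(1) sub order_refl]
      b_Omega_le_add_ideal[OF assms tukey(2) order_refl sub] by auto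
  have "Max_card {cof_ideal (NJ J), cof_ideal (NJ_star J)} \<in> {cof_ideal (NJ J), cof_ideal (NJ_star J)}"
    by (intro Max_card_greatest(1) Card_order_cof_ideal)
  then show "Max_card {cof_ideal (NJ J), cof_ideal (NJ_star J)} \<le>o d_Omega J"
    using cof_ideal_le_d_Omega[OF assms tukey(1)] cof_ideal_le_d_Omega[OF assms tukey(2)] by auto
qed

end
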